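(* Let $f$ be a function on $\mathbb R$ whose Fourier transform vanishes for negative arguments, normalised ($\int_0^\infty\frac{dp}{2p}|\tilde f(p)|^2=1$), such that $f$ and $f'$ exist and are integrable, and suppose there are constants $C>0$, $L\ge1$, $\alpha>1/2$ with $|f(y)|\le C/|y|^{1+\alpha}$ for $y\le -L$. For $y_o\in\mathbb R$ let $f_{y_o}(y)=f(y-y_o)$. Then for every $y_o>0$, \[ \big|\bar N[f_{y_o}]-\bar N^{Th}_{2\pi}[f_{y_o}]\big|\le \frac{1}{\alpha^2(2\alpha-1)}\,\frac{32\,C^2}{(y_o/4+L-1)^{2\alpha-1}}+e^{4L-y_o/4}\big(\|f\|_{L^1}+\|f'\|_{L^1}\big)^2,\] where the difference on the left is understood as $\int_0^\infty\frac{dk}{2k}\big(|\widetilde{\check{f}_{y_o}}(-k)|^2-|\widetilde{\check{f}_{y_o}}^{\,Th}(-k)|^2\big)$.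
   Context: Fourier transforms: $\tilde g(p)=(2\pi)^{-1/2}\int g(y)e^{-ipy}dy$. With $x(y)=-\log(1+e^{-y})$, for $k\ge0$: $\widetilde{\check f}(-k)=(2\pi)^{-1/2}\int_{\mathbb R} f(y)e^{ikx(y)}dy$ and $\widetilde{\check f}^{\,Th}(-k)=(2\pi)^{-1/2}\int_{\mathbb R} f(y)e^{-ike^{-y}}dy$. $\bar N[f]=\int_0^\infty\frac{dk}{2k}|\widetilde{\check f}(-k)|^2$ (mean number of created particles) and $\bar N^{Th}_{2\pi}[f]=\int_0^\infty\frac{dp}{2p}\frac{|\tilde f(p)|^2}{e^{2\pi p}-1}=\int_0^\infty\frac{dk}{2k}|\widetilde{\check f}^{\,Th}(-k)|^2$ (thermal average); each may be infinite individually. *)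

theory Defs
  imports "HOL-Analysis.Analysis"
begin

definition FT :: "(real \<Rightarrow> complex) \<Rightarrow> real \<Rightarrow> complex" where
  "FT g p = complex_of_real (1 / sqrt (2 * pi)) *
     integral UNIV (\<lambda>y. g y * exp (- \<i> * complex_of_real (p * y)))"

definition xmap :: "real \<Rightarrow> real" where
  "xmap y = - ln (1 + exp (- y))"

text \<open>checkFT f k is the quantity written tilde(check f)(-k) in the paper (k >= 0).\<close>
definition checkFT :: "(real \<Rightarrow> complex) \<Rightarrow> real \<Rightarrow> complex" where
  "checkFT f k = complex_of_real (1 / sqrt (2 * pi)) *
     integral UNIV (\<lambda>y. f y * exp (\<i> * complex_of_real (k * xmap y)))"

text \<open>checkFT_Th f k is the quantity written tilde(check f)^Th(-k) in the paper (k >= 0).\<close>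
definition checkFT_Th :: "(real \<Rightarrow> complex) \<Rightarrow> real \<Rightarrow> complex" where
  "checkFT_Th f k = complex_of_real (1 / sqrt (2 * pi)) *
     integral UNIV (\<lambda>y. f y * exp (- \<i> * complex_of_real (k * exp (- y))))"

definition L1norm :: "(real \<Rightarrow> complex) \<Rightarrow> real" where
  "L1norm g = integral UNIV (\<lambda>y. norm (g y))"

end

theory Submission
  imports Defs
begin

text \<open>Write \<open>G\<close> and \<open>H\<close> for the oscillatory integrals of the shifted function \<open>g\<close> against the phases
  \<open>k x(y)\<close> and \<open>- k exp (- y)\<close>. The \<open>k\<close>-integral is split at \<open>k\<^sub>0 = exp (a / 2 - 2 L)\<close>, where \<open>a = y\<^sub>o\<close>.

  For \<open>k < k\<^sub>0\<close> each of \<open>G\<close>, \<open>H\<close> is small by itself: the transform of \<open>f\<close> vanishes for negative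
  arguments, so by continuity \<open>g\<close> has mean zero and \<open>1\<close> may be subtracted from the exponential;
  cutting the integral at distance \<open>M = (a - ln k) / 2\<close> to the left of \<open>a\<close> leaves
  \<open>\<parallel>g\<parallel>\<^sub>1 k exp (M - a)\<close> plus a tail of order \<open>C / (\<alpha> M powr \<alpha>)\<close>, and
  \<open>M powr (- 2 \<alpha>)\<close> is integrable with respect to \<open>dk / k\<close> because \<open>2 \<alpha> > 1\<close>.

  For \<open>k \<ge> k\<^sub>0\<close> only the difference is small: since \<open>x(y) + exp (- y) = O(exp (- 2 y))\<close>, integrating both
  integrals by parts gives \<open>|G - H| = O(1 / sqrt k)\<close>.\<close>

section \<open>Absolutely integrable functions on the real line\<close>

text \<open>The condition on \<open>c\<close> covers translations and reflections, for which the
  Jacobian is 1.\<close>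

lemma absolutely_integrable_real_affine:
  fixes h :: "real \<Rightarrow> 'a::euclidean_space"
  assumes "h absolutely_integrable_on UNIV" and "\<bar>c\<bar> = 1"
  shows "(\<lambda>x. h (t + c * x)) absolutely_integrable_on UNIV"
    and "integral UNIV (\<lambda>x. h (t + c * x)) = integral UNIV h"
proof -
  have c: "c \<noteq> 0" using assms by auto
  have i: "integrable lebesgue h"
    using assms(1) by (simp add: set_integrable_def)
  have i': "integrable lebesgue (\<lambda>x. h (t + c * x))"
    using lebesgue_integrable_real_affine[OF i c] .
  show "(\<lambda>x. h (t + c * x)) absolutely_integrable_on UNIV"
    using i' by (simp add: set_integrable_def)
  show "integral UNIV (\<lambda>x. h (t + c * x)) = integral UNIV h"
    using integral_lebesgue[OF i] integral_lebesgue[OF i']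
      lebesgue_integral_real_affine[OF c, of h t] assms(2) by simp
qed

lemma absolutely_integrable_mult_continuous:
  fixes g u :: "real \<Rightarrow> complex"
  assumes g: "g absolutely_integrable_on UNIV"
    and u: "continuous_on UNIV u" and K: "\<And>y. cmod (u y) \<le> K"
  shows "(\<lambda>y. g y * u y) absolutely_integrable_on UNIV"
proof -
  have "(\<lambda>y. u y * g y) absolutely_integrable_on UNIV"
  proof (rule absolutely_integrable_bounded_measurable_product[OF bilinear_times _ _ _ g])
    show "u \<in> borel_measurable (lebesgue_on UNIV)"
      by (intro continuous_imp_measurable_on_sets_lebesgue u) auto
    show "bounded (range u)" using K by (auto simp: bounded_iff)
  qed auto
  then show ?thesis by (simp add: mult.commute)
qed

text \<open>A nonzero limit \<open>c\<close> would keep \<open>norm (u x)\<close> above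
  \<open>norm c / 2\<close> on a half-line, and a long enough interval there would already exceed
  the total integral of the norm.\<close>

lemma integrable_limit_at_top_zero:
  fixes u :: "real \<Rightarrow> 'a::euclidean_space"
  assumes u: "u absolutely_integrable_on UNIV" and lim: "(u \<longlongrightarrow> c) at_top"
  shows "c = 0"
proof (rule ccontr)
  assume "c \<noteq> 0"
  have "\<forall>\<^sub>F x in at_top. norm (u x) > norm c / 2"
    using order_tendstoD(1)[OF tendsto_norm[OF lim], of "norm c / 2"] \<open>c \<noteq> 0\<close> by simp
  then obtain T where T: "\<And>x. x \<ge> T \<Longrightarrow> norm c / 2 \<le> norm (u x)"
    by (force simp: eventually_at_top_linorder)
  let ?I = "integral UNIV (\<lambda>x. norm (u x))"
  obtain n :: nat where n: "?I < real n * (norm c / 2)"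
    using reals_Archimedean3[of "norm c / 2"] \<open>c \<noteq> 0\<close> by auto
  have nu: "(\<lambda>x. norm (u x)) integrable_on UNIV"
    using u by (simp add: absolutely_integrable_on_def)
  have "real n * (norm c / 2) = integral {T..T + n} (\<lambda>x. norm c / 2)"
    by simp
  also have "\<dots> \<le> integral {T..T + n} (\<lambda>x. norm (u x))"
    by (intro integral_le integrable_on_subinterval[OF nu])
      (auto dest: T)
  also have "\<dots> \<le> ?I"
    by (intro integral_subset_le integrable_on_subinterval[OF nu] nu) auto
  finally show False using n by simp
qed

text \<open>The integral of \<open>h'\<close> over \<open>{-t..t}\<close> is
  \<open>h t - h (- t)\<close>. As a function of \<open>t\<close> this is absolutely integrable and
  converges to the full integral, so the limit must be 0. The decay of \<open>h\<close> at either
  end need not be shown separately.\<close>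

lemma integral_derivative_eq_zero:
  fixes h h' :: "real \<Rightarrow> 'a::euclidean_space"
  assumes h: "h absolutely_integrable_on UNIV" and h': "h' absolutely_integrable_on UNIV"
    and der: "\<And>y. (h has_vector_derivative h' y) (at y)"
  shows "integral UNIV h' = 0"
proof (rule integrable_limit_at_top_zero)
  let ?u = "\<lambda>t. h t - h (- t)"
  show "?u absolutely_integrable_on UNIV"
    using absolutely_integrable_real_affine(1)[OF h, of "-1" 0] h
    by (intro set_integral_diff) auto
  have ev: "\<forall>\<^sub>F t::real in at_top. integral {-t..t} h' = ?u t"
  proof (rule eventually_mono[OF eventually_ge_at_top[of 0]])
    fix t :: real assume "0 \<le> t"
    then show "integral {-t..t} h' = ?u t"
      by (intro integral_unique fundamental_theorem_of_calculus)
        (auto intro: has_vector_derivative_at_within der)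
  qed
  have hi: "(h' has_integral integral UNIV h') UNIV"
    using h' by (auto simp: absolutely_integrable_on_def intro: integrable_integral)
  have "((\<lambda>t. integral {-t..t} h') \<longlongrightarrow> integral UNIV h') at_top"
  proof (rule tendstoI)
    fix e :: real assume "e > 0"
    then obtain B where "B > 0" and B: "\<And>a b. ball 0 B \<subseteq> cbox a b \<Longrightarrow>
        norm (integral (cbox a b) h' - integral UNIV h') < e"
      using hi unfolding has_integral_alt'[of h'] by auto
    show "\<forall>\<^sub>F t in at_top. dist (integral {-t..t} h') (integral UNIV h') < e"
      using eventually_ge_at_top[of B]
    proof eventually_elim
      case (elim t)
      then have "ball 0 B \<subseteq> cbox (-t) t" by (auto simp: dist_real_def)
      then show ?case using B[of "-t" t] by (simp add: dist_norm)
    qed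
  qed
  then show "(?u \<longlongrightarrow> integral UNIV h') at_top"
    using ev by (simp add: filterlim_cong)
qed

section \<open>Elementary bounds for phases and the logarithm\<close>

text \<open>A chord of the unit circle, of length \<open>2 * \<bar>sin ((s - t) / 2)\<bar>\<close>,
  is no longer than its arc.\<close>

lemma cmod_cis_diff_le: "cmod (cis s - cis t) \<le> \<bar>s - t\<bar>"
proof -
  have "cis s - cis t = cis t * (cis (s - t) - 1)"
    by (simp add: algebra_simps cis_mult)
  then have "cmod (cis s - cis t) = 2 * \<bar>sin ((s - t) / 2)\<bar>"
    using dist_exp_i_1[of "s - t"] by (simp add: norm_mult cis_conv_exp)
  also have "\<dots> \<le> \<bar>s - t\<bar>"
    using abs_sin_le_one abs_sin_x_le_abs_x[of "(s - t) / 2"] by simp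
  finally show ?thesis .
qed

lemma cmod_cis_diff_le_2: "cmod (cis s - cis t) \<le> 2"
  using norm_triangle_ineq4[of "cis s" "cis t"] by simp

text \<open>Used with \<open>u = exp (- y)\<close>: the first bound controls \<open>xmap\<close>
  itself, the second its distance from \<open>- exp (- y)\<close>.\<close>

lemma diff_ln_one_plus_bounds:
  fixes u :: real
  assumes "u > 0"
  shows "ln (1 + u) \<le> u" and "u - ln (1 + u) \<le> u\<^sup>2"
proof -
  show "ln (1 + u) \<le> u" using assms by (simp add: ln_add_one_self_le_self)
  show "u - ln (1 + u) \<le> u\<^sup>2"
  proof (cases "u \<le> 1")
    case True
    then show ?thesis using ln_one_plus_pos_lower_bound[of u] assms by simp
  next
    case False
    then have "u \<le> u\<^sup>2" by (simp add: power2_eq_square)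
    moreover have "0 \<le> ln (1 + u)" using assms by simp
    ultimately show ?thesis by linarith
  qed
qed

section \<open>Oscillatory integrals with a general phase\<close>

text \<open>Up to the factor \<open>1 / sqrt (2 * pi)\<close>, the phases \<open>- y\<close>,
  \<open>xmap y\<close> and \<open>- exp (- y)\<close> give \<open>FT\<close>,
  \<open>checkFT\<close> and \<open>checkFT_Th\<close>, so each estimate is proved once for all of
  them.\<close>

definition osc :: "(real \<Rightarrow> complex) \<Rightarrow> (real \<Rightarrow> real) \<Rightarrow> real \<Rightarrow> complex" where
  "osc g \<phi> k = integral UNIV (\<lambda>y. g y * cis (k * \<phi> y))"

lemma absolutely_integrable_osc:
  fixes g :: "real \<Rightarrow> complex"
  assumes "g absolutely_integrable_on UNIV" and "continuous_on UNIV \<phi>"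
  shows "(\<lambda>y. g y * cis (k * \<phi> y)) absolutely_integrable_on UNIV"
  using assms(2)
  by (intro absolutely_integrable_mult_continuous[OF assms(1), where K = 1])
    (auto intro!: continuous_intros simp: cis_conv_exp)

lemma norm_osc_le:
  assumes "g absolutely_integrable_on UNIV" and "continuous_on UNIV \<phi>"
  shows "cmod (osc g \<phi> k) \<le> L1norm g"
  unfolding osc_def L1norm_def
  using absolutely_integrable_osc[OF assms, of k] assms(1)
  by (intro integral_norm_bound_integral) (auto simp: absolutely_integrable_on_def norm_mult)

text \<open>Dominated convergence with majorant \<open>norm (g y)\<close>. Continuity serves twice:
  at frequency 0 for the mean of \<open>g\<close>, and for measurability of the final integrand in
  \<open>k\<close>.\<close>

lemma continuous_on_osc:
  assumes g: "g absolutely_integrable_on UNIV" and \<phi>: "continuous_on UNIV \<phi>"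
  shows "continuous_on S (osc g \<phi>)"
  unfolding continuous_on_sequentially comp_def osc_def
proof (intro allI impI ballI)
  fix X k assume X: "(\<forall>n. X n \<in> S) \<and> X \<longlonglongrightarrow> k"
  show "(\<lambda>n. integral UNIV (\<lambda>y. g y * cis (X n * \<phi> y)))
      \<longlonglongrightarrow> integral UNIV (\<lambda>y. g y * cis (k * \<phi> y))"
  proof (rule dominated_convergence(2)[where h = "\<lambda>y. norm (g y)"])
    show "(\<lambda>y. g y * cis (X n * \<phi> y)) integrable_on UNIV" for n
      using absolutely_integrable_osc[OF g \<phi>] by (auto simp: absolutely_integrable_on_def)
    show "(\<lambda>n. g y * cis (X n * \<phi> y)) \<longlonglongrightarrow> g y * cis (k * \<phi> y)" for y
      unfolding cis_conv_exp using X by (intro tendsto_intros) auto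
  qed (use g in \<open>auto simp: absolutely_integrable_on_def norm_mult\<close>)
qed

lemma FT_eq_osc: "FT g p = complex_of_real (1 / sqrt (2 * pi)) * osc g (\<lambda>y. - y) p"
  by (simp add: FT_def osc_def cis_conv_exp)

lemma checkFT_eq_osc: "checkFT g k = complex_of_real (1 / sqrt (2 * pi)) * osc g xmap k"
  by (simp add: checkFT_def osc_def cis_conv_exp)

lemma checkFT_Th_eq_osc:
  "checkFT_Th g k = complex_of_real (1 / sqrt (2 * pi)) * osc g (\<lambda>y. - exp (- y)) k"
  by (simp add: checkFT_Th_def osc_def cis_conv_exp)

section \<open>Mean zero and the low-frequency bound\<close>

text \<open>The integral of \<open>g\<close> is the unnormalised transform at 0, hence by continuity
  the limit from the left of a function vanishing there.\<close>

lemma integral_eq_zero_if_FT_neg: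
  assumes g: "g absolutely_integrable_on UNIV" and neg: "\<And>p. p < 0 \<Longrightarrow> FT g p = 0"
  shows "integral UNIV g = 0"
proof -
  have "isCont (osc g (\<lambda>y. - y)) 0"
    using continuous_on_osc[OF g, of "\<lambda>y. - y" UNIV]
    by (auto simp: continuous_on_eq_continuous_at intro!: continuous_intros)
  then have "(osc g (\<lambda>y. - y) \<longlongrightarrow> osc g (\<lambda>y. - y) 0) (at_left 0)"
    by (simp add: isCont_def filterlim_at_split)
  moreover have "\<forall>\<^sub>F p in at_left 0. osc g (\<lambda>y. - y) p = 0"
    using neg by (intro eventually_at_leftI[of "-1"]) (auto simp: FT_eq_osc)
  ultimately have "osc g (\<lambda>y. - y) 0 = 0"
    using tendsto_unique tendsto_eventually trivial_limit_at_left_real by blast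
  then show ?thesis by (simp add: osc_def)
qed

text \<open>Mean zero allows 1 to be subtracted from the oscillating factor. Right of
  \<open>z\<close> the difference is at most the phase, hence at most \<open>k * exp (- z)\<close>;
  left of \<open>z\<close> it is only at most 2, which leaves the tail of \<open>g\<close>. The cut
  \<open>z\<close> stays free so that it can depend on \<open>k\<close>.\<close>

lemma norm_osc_low_frequency:
  assumes g: "g absolutely_integrable_on UNIV" and \<phi>: "continuous_on UNIV \<phi>"
    and mean: "integral UNIV g = 0" and bound: "\<And>y. \<bar>\<phi> y\<bar> \<le> exp (- y)" and "k \<ge> 0"
  shows "cmod (osc g \<phi> k) \<le> L1norm g * (k * exp (- z)) + 2 * integral {..z} (\<lambda>y. norm (g y))"
proof -
  have ng: "(\<lambda>y. norm (g y)) integrable_on UNIV" and gi: "g integrable_on UNIV"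
    using g by (auto simp: absolutely_integrable_on_def)
  have ng': "(\<lambda>y. norm (g y)) integrable_on {..z}"
    using set_integrable_subset[OF g, of "{..z}"] by (auto simp: absolutely_integrable_on_def)
  let ?T = "\<lambda>y. if y \<in> {..z} then norm (g y) else 0"
  have T: "?T integrable_on UNIV" "integral UNIV ?T = integral {..z} (\<lambda>y. norm (g y))"
    using ng' by (auto simp only: integrable_restrict_UNIV integral_restrict_UNIV)
  have o: "(\<lambda>y. g y * cis (k * \<phi> y)) integrable_on UNIV"
    using absolutely_integrable_osc[OF g \<phi>] by (auto simp: absolutely_integrable_on_def)
  have "osc g \<phi> k = integral UNIV (\<lambda>y. g y * cis (k * \<phi> y) - g y)"
    using o gi mean by (simp add: osc_def integral_diff)
  also have "cmod \<dots> \<le> integral UNIV (\<lambda>y. norm (g y) * (k * exp (- z)) + 2 * ?T y)"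
  proof (intro integral_norm_bound_integral integrable_diff o gi integrable_add
      integrable_on_mult_left integrable_on_mult_right ng T)
    fix y
    have e: "cmod (g y * cis (k * \<phi> y) - g y) = cmod (g y) * cmod (cis (k * \<phi> y) - cis 0)"
      by (simp flip: norm_mult add: algebra_simps)
    show "cmod (g y * cis (k * \<phi> y) - g y) \<le> norm (g y) * (k * exp (- z)) + 2 * ?T y"
    proof (cases "y \<le> z")
      case True
      have "0 \<le> norm (g y) * (k * exp (- z))" using \<open>k \<ge> 0\<close> by simp
      moreover have "cmod (g y) * cmod (cis (k * \<phi> y) - cis 0) \<le> cmod (g y) * 2"
        by (intro mult_left_mono cmod_cis_diff_le_2) auto
      ultimately show ?thesis using True unfolding e by simp
    next
      case False
      have "\<bar>\<phi> y\<bar> \<le> exp (- z)" by (rule order_trans[OF bound]) (use False in simp)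
      then have "\<bar>k * \<phi> y - 0\<bar> \<le> k * exp (- z)"
        using \<open>k \<ge> 0\<close> by (simp add: abs_mult mult_left_mono)
      then have "cmod (cis (k * \<phi> y) - cis 0) \<le> k * exp (- z)"
        using cmod_cis_diff_le order_trans by blast
      then have "cmod (g y) * cmod (cis (k * \<phi> y) - cis 0) \<le> cmod (g y) * (k * exp (- z))"
        by (rule mult_left_mono) auto
      then show ?thesis using False unfolding e by simp
    qed
  qed
  also have "\<dots> = L1norm g * (k * exp (- z)) + 2 * integral {..z} (\<lambda>y. norm (g y))"
    using ng T by (subst integral_add) (auto simp: L1norm_def integrable_on_mult_left integrable_on_mult_right)
  finally show ?thesis .
qed

section \<open>The two phases and the high-frequency bound\<close>

lemma has_vector_derivative_cis:
  assumes "(\<phi> has_real_derivative d) (at y)"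
  shows "((\<lambda>y. cis (\<phi> y)) has_vector_derivative (\<i> * of_real d * cis (\<phi> y))) (at y)"
  using has_derivative_cis[OF assms[unfolded has_field_derivative_def]]
  by (simp add: has_vector_derivative_def scaleR_conv_of_real mult_ac)

lemma continuous_on_neg_exp_neg: "continuous_on S (\<lambda>y::real. - exp (- y))"
  by (intro continuous_intros)

lemma continuous_on_xmap: "continuous_on S xmap"
  unfolding xmap_def by (intro continuous_intros) (auto simp: add_pos_pos less_imp_neq[symmetric])

lemma xmap_has_derivative: "(xmap has_real_derivative 1 / (1 + exp y)) (at y)"
proof -
  have "((\<lambda>y. - ln (1 + exp (- y))) has_real_derivative exp (- y) / (1 + exp (- y))) (at y)"
    by (auto intro!: derivative_eq_intros simp: add_pos_pos)
  moreover have "exp (- y) / (1 + exp (- y)) = 1 / (1 + exp y)"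
    by (simp add: exp_minus field_simps)
  ultimately show ?thesis by (simp add: xmap_def[abs_def])
qed

lemma abs_xmap_le: "\<bar>xmap y\<bar> \<le> exp (- y)"
  using diff_ln_one_plus_bounds(1)[of "exp (- y)"] by (simp add: xmap_def)

lemma abs_xmap_plus_exp_le: "\<bar>xmap y + exp (- y)\<bar> \<le> (exp (- y))\<^sup>2"
  using diff_ln_one_plus_bounds[of "exp (- y)"] by (simp add: xmap_def)

definition phase_gap :: "real \<Rightarrow> real \<Rightarrow> complex" where
  "phase_gap k y = cis (k * xmap y) - cis (k * - exp (- y))"

text \<open>The gap is at most 2 and at most \<open>k * (exp (- y))\<^sup>2\<close>. After
  multiplication by \<open>exp y\<close> the first bound is good for
  \<open>exp y \<le> sqrt k\<close>, the second beyond.\<close>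

lemma norm_exp_phase_gap_le:
  assumes "k \<ge> 0"
  shows "cmod (exp y *\<^sub>R phase_gap k y) \<le> 2 * sqrt k"
proof (cases "exp y \<le> sqrt k")
  case True
  have "exp y * cmod (phase_gap k y) \<le> sqrt k * 2"
    using True assms cmod_cis_diff_le_2 unfolding phase_gap_def by (intro mult_mono) auto
  then show ?thesis by simp
next
  case False
  have "cmod (phase_gap k y) \<le> \<bar>k * xmap y - k * - exp (- y)\<bar>"
    unfolding phase_gap_def by (rule cmod_cis_diff_le)
  also have "\<dots> = k * \<bar>xmap y + exp (- y)\<bar>"
    using assms by (simp add: abs_mult flip: distrib_left)
  also have "\<dots> \<le> k * (exp (- y))\<^sup>2"
    by (intro mult_left_mono abs_xmap_plus_exp_le assms)
  finally have "exp y * cmod (phase_gap k y) \<le> exp y * (k * (exp (- y))\<^sup>2)"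
    by simp
  also have "\<dots> = k / exp y"
    by (simp add: exp_minus power2_eq_square field_simps)
  also have "\<dots> \<le> sqrt k"
  proof -
    have "k = sqrt k * sqrt k" using assms by simp
    also have "\<dots> \<le> sqrt k * exp y" using False assms by (intro mult_left_mono) auto
    finally show ?thesis by (simp add: field_simps)
  qed
  also have "\<dots> \<le> 2 * sqrt k" using assms by simp
  finally show ?thesis by simp
qed

text \<open>Both integrations by parts are carried out at once: their
  amplitudes \<open>exp y\<close> and \<open>1 + exp y\<close> are separately unbounded, whereas their
  phase-weighted difference is of order \<open>sqrt k\<close>, so that no boundary terms arise.\<close>
lemma norm_osc_diff_high_frequency:
  assumes g: "g absolutely_integrable_on UNIV" and g': "g' absolutely_integrable_on UNIV"
    and der: "\<And>y. (g has_vector_derivative g' y) (at y)" and k: "k > 0"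
  shows "cmod (osc g xmap k - osc g (\<lambda>y. - exp (- y)) k)
    \<le> L1norm g' / k + 2 * (L1norm g + L1norm g') / sqrt k"
proof -
  define c where "c = (\<lambda>y. cis (k * xmap y))"
  define w where "w = (\<lambda>y. exp y *\<^sub>R phase_gap k y)"
  have cont: "continuous_on UNIV c" "continuous_on UNIV (phase_gap k)" "continuous_on UNIV w"
    unfolding c_def w_def phase_gap_def cis_conv_exp
    by (intro continuous_intros continuous_on_xmap)+
  have bd: "cmod (c y) \<le> 1" "cmod (phase_gap k y) \<le> 2" "cmod (w y) \<le> 2 * sqrt k" for y
    using norm_exp_phase_gap_le[of k y] k cmod_cis_diff_le_2
    unfolding c_def w_def phase_gap_def by auto
  note ai = absolutely_integrable_mult_continuous
  have int: "(\<lambda>y. g y * c y) absolutely_integrable_on UNIV"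
    "(\<lambda>y. g y * w y) absolutely_integrable_on UNIV"
    "(\<lambda>y. g' y * c y) absolutely_integrable_on UNIV"
    "(\<lambda>y. g' y * w y) absolutely_integrable_on UNIV"
    "(\<lambda>y. g y * phase_gap k y) absolutely_integrable_on UNIV"
    using ai[OF g cont(1) bd(1)] ai[OF g cont(3) bd(3)] ai[OF g' cont(1) bd(1)]
      ai[OF g' cont(3) bd(3)] ai[OF g cont(2) bd(2)] by auto
  \<comment> \<open>\<open>r\<close> is the part of the derivative of \<open>h\<close> without an
    explicit factor \<open>k\<close>; its integral divided by \<open>k\<close> will bound the
    difference.\<close>
  define r where "r = (\<lambda>y. g' y * c y + (g' y * w y + g y * w y))"
  have r: "r absolutely_integrable_on UNIV"
    unfolding r_def by (intro set_integral_add int)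
  \<comment> \<open>This is \<open>g y\<close> times
    \<open>(1 + exp y) * c y - exp y * cis (k * - exp (- y))\<close>, whose amplitudes are the
    reciprocals of the derivatives of the two phases. In the grouping chosen every factor beside
    \<open>g\<close> is bounded.\<close>
  define h where "h = (\<lambda>y. g y * c y + g y * w y)"
  define h' where "h' = (\<lambda>y. r y + (\<i> * of_real k) * (g y * phase_gap k y))"
  have "integral UNIV h' = 0"
  proof (rule integral_derivative_eq_zero)
    show "h absolutely_integrable_on UNIV"
      unfolding h_def by (intro set_integral_add int)
    show "h' absolutely_integrable_on UNIV"
      unfolding h'_def by (intro set_integral_add set_integrable_mult_right int r)
    fix y
    have c': "(c has_vector_derivative (\<i> * of_real (k * (1 / (1 + exp y))) * c y)) (at y)"
      unfolding c_def
      by (intro has_vector_derivative_cis DERIV_cmult xmap_has_derivative)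
    have e': "((\<lambda>y. cis (k * - exp (- y))) has_vector_derivative
        (\<i> * of_real (k * exp (- y)) * cis (k * - exp (- y)))) (at y)"
      by (intro has_vector_derivative_cis DERIV_cmult) (auto intro!: derivative_eq_intros)
    have x: "(exp has_real_derivative exp y) (at y)" by (auto intro!: derivative_eq_intros)
    have p': "(phase_gap k has_vector_derivative \<i> * of_real (k * (1 / (1 + exp y))) * c y
         - \<i> * of_real (k * exp (- y)) * cis (k * - exp (- y))) (at y)" (is "(_ has_vector_derivative ?p) _")
      unfolding phase_gap_def[abs_def]
      using has_vector_derivative_diff[OF c' e'] by (simp add: c_def)
    have w': "(w has_vector_derivative exp y *\<^sub>R ?p + exp y *\<^sub>R phase_gap k y) (at y)"
      unfolding w_def by (rule has_vector_derivative_scaleR[OF x p'])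
    have "(h has_vector_derivative (g y * (\<i> * of_real (k * (1 / (1 + exp y))) * c y) + g' y * c y) +
        (g y * (exp y *\<^sub>R ?p + exp y *\<^sub>R phase_gap k y) + g' y * w y)) (at y)"
      unfolding h_def
      by (intro has_vector_derivative_add has_vector_derivative_mult der c' w')
    moreover have "(g y * (\<i> * of_real (k * (1 / (1 + exp y))) * c y) + g' y * c y) +
        (g y * (exp y *\<^sub>R ?p + exp y *\<^sub>R phase_gap k y) + g' y * w y) = h' y"
    proof -
      \<comment> \<open>The subtracted term cancels the contribution of the derivative of
        \<open>c\<close> in \<open>g y * c y\<close>.\<close>
      have 1: "exp y * (k * (1 / (1 + exp y))) = k - k * (1 / (1 + exp y))"
        by (simp add: field_simps add_pos_pos less_imp_neq[symmetric])
      have 2: "exp y * (k * exp (- y)) = k" by (simp add: exp_minus)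
      have "exp y *\<^sub>R ?p = \<i> * of_real (exp y * (k * (1 / (1 + exp y)))) * c y
         - \<i> * of_real (exp y * (k * exp (- y))) * cis (k * - exp (- y))"
        by (simp add: scaleR_conv_of_real algebra_simps)
      also have "\<dots> = \<i> * of_real k * phase_gap k y - \<i> * of_real (k * (1 / (1 + exp y))) * c y"
        unfolding 1 2 phase_gap_def c_def by (simp add: algebra_simps)
      finally have 3: "exp y *\<^sub>R ?p = \<dots>" .
      show ?thesis unfolding 3 h'_def r_def w_def by (simp add: algebra_simps)
    qed
    ultimately show "(h has_vector_derivative h' y) (at y)" by simp
  qed
  moreover have "integral UNIV h' = integral UNIV r + \<i> * of_real k * integral UNIV (\<lambda>y. g y * phase_gap k y)"
    using r int(5) unfolding h'_def
    by (subst integral_add) (auto simp: absolutely_integrable_on_def intro: integrable_on_mult_right)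
  moreover have "integral UNIV (\<lambda>y. g y * phase_gap k y) = osc g xmap k - osc g (\<lambda>y. - exp (- y)) k"
    using absolutely_integrable_osc[OF g continuous_on_xmap, of k]
      absolutely_integrable_osc[OF g continuous_on_neg_exp_neg, of k]
    unfolding osc_def phase_gap_def right_diff_distrib[of "g _"]
    by (subst integral_diff) (auto simp: absolutely_integrable_on_def)
  ultimately have "\<i> * of_real k * (osc g xmap k - osc g (\<lambda>y. - exp (- y)) k) = - integral UNIV r"
    by (simp add: eq_neg_iff_add_eq_0 add.commute)
  then have "k * cmod (osc g xmap k - osc g (\<lambda>y. - exp (- y)) k) = cmod (integral UNIV r)"
    using k by (metis abs_of_pos norm_ii norm_minus_cancel norm_mult norm_of_real mult_1)
  also have "\<dots> \<le> integral UNIV (\<lambda>y. norm (g' y) + 2 * sqrt k * (norm (g' y) + norm (g y)))"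
  proof (rule integral_norm_bound_integral)
    show "r integrable_on UNIV" using r by (simp add: absolutely_integrable_on_def)
    show "(\<lambda>y. norm (g' y) + 2 * sqrt k * (norm (g' y) + norm (g y))) integrable_on UNIV"
      using g g' by (intro integrable_add integrable_on_mult_right) (auto simp: absolutely_integrable_on_def)
    fix y
    have "cmod (r y) \<le> cmod (g' y) * cmod (c y) + (cmod (g' y) * cmod (w y) + cmod (g y) * cmod (w y))"
      unfolding r_def norm_mult[symmetric] by (intro norm_triangle_le add_mono order_refl)
    also have "\<dots> \<le> cmod (g' y) * 1 + (cmod (g' y) * (2 * sqrt k) + cmod (g y) * (2 * sqrt k))"
      by (intro add_mono mult_left_mono bd) auto
    finally show "cmod (r y) \<le> norm (g' y) + 2 * sqrt k * (norm (g' y) + norm (g y))"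
      by (simp add: algebra_simps)
  qed
  also have "\<dots> = L1norm g' + 2 * sqrt k * (L1norm g' + L1norm g)"
    using g g' unfolding L1norm_def
    by (subst integral_add) (auto simp: absolutely_integrable_on_def integral_add
        intro!: integrable_add integrable_on_mult_right)
  finally have "cmod (osc g xmap k - osc g (\<lambda>y. - exp (- y)) k)
      \<le> (L1norm g' + 2 * sqrt k * (L1norm g' + L1norm g)) / k"
    using k by (simp add: pos_le_divide_eq mult.commute)
  also have "\<dots> = L1norm g' / k + 2 * (L1norm g + L1norm g') * (sqrt k / k)"
    by (simp add: add_divide_distrib algebra_simps)
  also have "sqrt k / k = 1 / sqrt k"
    using k by (simp add: field_simps)
  finally show ?thesis by simp
qed

section \<open>Decay of the tail and the logarithmic weight\<close>

lemma tail_integral_le: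
  fixes f :: "real \<Rightarrow> complex"
  assumes f: "f absolutely_integrable_on UNIV"
    and decay: "\<And>y. y \<le> - M \<Longrightarrow> cmod (f y) \<le> C / \<bar>y\<bar> powr (1 + \<alpha>)"
    and M: "M > 0" and \<alpha>: "\<alpha> > 0"
  shows "integral {..a - M} (\<lambda>y. cmod (f (y - a))) \<le> C / (\<alpha> * M powr \<alpha>)"
proof -
  \<comment> \<open>The decay bound at \<open>- M\<close> forces this sign, which makes the majorant
    \<open>?p\<close> nonnegative.\<close>
  have C: "C \<ge> 0"
    using decay[of "- M"] M norm_ge_zero[of "f (- M)"]
    by (smt (verit) divide_neg_pos powr_gt_zero)
  let ?n = "\<lambda>y. if y \<in> {..- M} then cmod (f y) else 0"
  let ?p = "\<lambda>y. if y \<in> {M..} then C * y powr (- (1 + \<alpha>)) else 0"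
  have "(\<lambda>y. cmod (f y)) absolutely_integrable_on {..- M}"
    using set_integrable_subset[OF f, of "{..- M}"] by (auto intro: absolutely_integrable_norm[unfolded o_def])
  then have n: "?n absolutely_integrable_on UNIV"
    by (simp only: absolutely_integrable_restrict_UNIV)
  have pI: "(?p has_integral C * (M powr (- \<alpha>) / \<alpha>)) UNIV"
    unfolding has_integral_restrict_UNIV
    using has_integral_mult_right[OF has_integral_powr_to_inf[of "- (1 + \<alpha>)" M], of C] M \<alpha> by simp
  have p: "?p absolutely_integrable_on UNIV"
    using pI C by (intro nonnegative_absolutely_integrable_1) (auto simp: integrable_on_def)
  have "integral {..a - M} (\<lambda>y. cmod (f (y - a))) = integral UNIV (\<lambda>y. ?n (- a + 1 * y))"
    unfolding integral_restrict_UNIV[of "{..a - M}", symmetric]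
    by (intro integral_cong) (auto simp: algebra_simps)
  also have "\<dots> = integral UNIV ?n"
    by (rule absolutely_integrable_real_affine(2)[OF n]) simp
  \<comment> \<open>The majorant lives on \<open>{M..}\<close>, where the improper integral of a
    power is known, and is reflected for the comparison.\<close>
  also have "\<dots> \<le> integral UNIV (\<lambda>y. ?p (0 + (- 1) * y))"
  proof (rule integral_le)
    show "?n integrable_on UNIV" using n by (rule set_lebesgue_integral_eq_integral)
    show "(\<lambda>y. ?p (0 + (- 1) * y)) integrable_on UNIV"
      using absolutely_integrable_real_affine(1)[OF p, of "- 1" 0]
      by (intro set_lebesgue_integral_eq_integral) simp
    show "?n y \<le> ?p (0 + (- 1) * y)" for y
      using decay[of y] M powr_minus_divide[of "- y" "1 + \<alpha>"] by auto
  qed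
  also have "\<dots> = integral UNIV ?p"
    by (rule absolutely_integrable_real_affine(2)[OF p]) simp
  also have "\<dots> = C / (\<alpha> * M powr \<alpha>)"
    using integral_unique[OF pI] by (simp add: powr_minus divide_inverse mult_ac)
  finally show ?thesis .
qed

text \<open>The substitution \<open>m = (a - ln k) / 2\<close> turns \<open>dk / k\<close> into
  \<open>- 2 dm\<close> and the interval into \<open>m > M\<close>. The antiderivative tends to 0 as
  \<open>k\<close> decreases to 0 because \<open>1 - \<beta>\<close> is negative.\<close>

lemma has_integral_log_powr:
  fixes a M \<beta> :: real
  assumes M: "M > 0" and \<beta>: "\<beta> > 1"
  shows "((\<lambda>k. ((a - ln k) / 2) powr (- \<beta>) / k) has_integral 2 / (\<beta> - 1) * M powr (1 - \<beta>))
    {0<..<exp (a - 2 * M)}"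
proof -
  let ?b = "exp (a - 2 * M)"
  let ?f = "\<lambda>k. ((a - ln k) / 2) powr (- \<beta>) / k"
  let ?F = "\<lambda>k. 2 / (\<beta> - 1) * ((a - ln k) / 2) powr (1 - \<beta>)"
  have pos: "(a - ln k) / 2 > 0" if "0 < k" "k < ?b" for k
  proof -
    have "ln k < a - 2 * M" using that by (metis ln_less_cancel_iff ln_exp exp_gt_zero)
    then show ?thesis using M by simp
  qed
  have der: "(?F has_real_derivative ?f k) (at k)" if "0 < k" "k < ?b" for k
  proof -
    have "(?F has_real_derivative 2 / (\<beta> - 1) *
        ((1 - \<beta>) * ((a - ln k) / 2) powr (1 - \<beta> - 1) * (- (1 / k) / 2))) (at k)"
      using that pos[OF that] \<beta> by (auto intro!: derivative_eq_intros simp: divide_simps)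
    moreover have "2 / (\<beta> - 1) * ((1 - \<beta>) * ((a - ln k) / 2) powr (1 - \<beta> - 1) * (- (1 / k) / 2)) = ?f k"
      using \<beta> that(1) by (simp add: divide_simps) (simp add: algebra_simps)
    ultimately show ?thesis by simp
  qed
  have lim0: "(?F \<longlongrightarrow> 0) (at_right 0)"
    using \<beta> by real_asymp
  have "isCont ?F ?b"
    using M by (intro continuous_intros) auto
  then have lim1: "(?F \<longlongrightarrow> ?F ?b) (at_left ?b)"
    by (simp add: isCont_def filterlim_at_split)
  have A: "((?F \<circ> real_of_ereal) \<longlongrightarrow> 0) (at_right (ereal 0))"
    using lim0 by (simp only: ereal_tendsto_simps)
  have B: "((?F \<circ> real_of_ereal) \<longlongrightarrow> ?F ?b) (at_left (ereal ?b))"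
    using lim1 by (simp only: ereal_tendsto_simps)
  have cont: "isCont ?f k" if "0 < k" "k < ?b" for k
    using that pos[OF that] by (intro continuous_intros) auto
  \<comment> \<open>For a nonnegative integrand the fundamental theorem also delivers integrability
    up to the singular endpoint 0.\<close>
  have nn: "AE k in lborel. ereal 0 < ereal k \<longrightarrow> ereal k < ereal ?b \<longrightarrow> 0 \<le> ?f k"
    by auto
  have le: "ereal 0 < ereal ?b" by simp
  note FTC = interval_integral_FTC_nonneg[OF le _ _ nn A B]
  have si: "set_integrable lborel (einterval (ereal 0) (ereal ?b)) ?f"
    by (rule FTC(1)) (use der cont in auto)
  have "(LBINT k=ereal 0..ereal ?b. ?f k) = ?F ?b - 0"
    by (rule FTC(2)) (use der cont in auto)
  then have "integral (einterval 0 ?b) ?f = ?F ?b"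
    using interval_integral_eq_integral'[OF _ si] by (simp add: zero_ereal_def)
  moreover have "?f integrable_on einterval 0 ?b"
    using set_borel_integral_eq_integral(1)[OF si] by (simp add: zero_ereal_def)
  moreover have "einterval 0 ?b = {0<..<?b}"
    by (auto simp: einterval_def)
  ultimately show ?thesis
    by (simp add: has_integral_iff)
qed

text \<open>With the cut at \<open>a - M\<close>, \<open>M = (a - ln k) / 2\<close>, the first term
  of the low-frequency bound is proportional to \<open>sqrt k\<close>, so its square over
  \<open>k\<close> is constant in \<open>k\<close>; the square of the tail becomes the logarithmic
  weight.\<close>

lemma norm_osc_low_frequency_decay:
  fixes g :: "real \<Rightarrow> complex"
  assumes g: "g absolutely_integrable_on UNIV" and \<phi>: "continuous_on UNIV \<phi>"
    and mean: "integral UNIV g = 0" and bound: "\<And>y. \<bar>\<phi> y\<bar> \<le> exp (- y)" and k: "k > 0"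
    and tail: "integral {..a - (a - ln k) / 2} (\<lambda>y. cmod (g y)) \<le> C / (\<alpha> * ((a - ln k) / 2) powr \<alpha>)"
    and pos: "a > ln k"
  shows "(cmod (osc g \<phi> k))\<^sup>2 / k \<le> 2 * (L1norm g)\<^sup>2 * exp (- a)
    + 8 * C\<^sup>2 / \<alpha>\<^sup>2 * (((a - ln k) / 2) powr (- (2 * \<alpha>)) / k)"
proof -
  define M where "M = (a - ln k) / 2"
  define T where "T = C / (\<alpha> * M powr \<alpha>)"
  have "M > 0" using pos by (simp add: M_def)
  have "cmod (osc g \<phi> k) \<le> L1norm g * (k * exp (- (a - M))) + 2 * integral {..a - M} (\<lambda>y. cmod (g y))"
    by (rule norm_osc_low_frequency[OF g \<phi> mean bound]) (use k in simp)
  also have "\<dots> \<le> L1norm g * (k * exp (- (a - M))) + 2 * T"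
    using tail by (simp add: M_def T_def)
  finally have "(cmod (osc g \<phi> k))\<^sup>2 \<le> (L1norm g * (k * exp (- (a - M))) + 2 * T)\<^sup>2"
    by (intro power_mono) auto
  \<comment> \<open>The inequality
    \<open>(u + v)\<^sup>2 \<le> 2 * u\<^sup>2 + 2 * v\<^sup>2\<close> with
    \<open>v = 2 * T\<close>.\<close>
  also have "\<dots> \<le> 2 * (L1norm g * (k * exp (- (a - M))))\<^sup>2 + 8 * T\<^sup>2"
    using zero_le_power2[of "L1norm g * (k * exp (- (a - M))) - 2 * T"]
    by (simp add: power2_diff power2_sum)
  also have "(L1norm g * (k * exp (- (a - M))))\<^sup>2 = (L1norm g)\<^sup>2 * exp (- a) * k"
  proof -
    have "(exp (- (a - M)))\<^sup>2 = exp (- a - ln k)"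
      by (simp add: M_def flip: exp_double)
    also have "\<dots> = exp (- a) / k" using k by (simp add: exp_diff)
    finally show ?thesis using k by (simp add: power_mult_distrib) (simp add: power2_eq_square)
  qed
  also have "T\<^sup>2 = C\<^sup>2 / \<alpha>\<^sup>2 * M powr (- (2 * \<alpha>))"
  proof -
    have "(M powr \<alpha>)\<^sup>2 = M powr (2 * \<alpha>)"
      by (simp only: power2_eq_square powr_add[symmetric]) simp
    then show ?thesis
      by (simp add: T_def power_divide power_mult_distrib powr_minus_divide)
  qed
  finally have "(cmod (osc g \<phi> k))\<^sup>2 / k \<le> (2 * ((L1norm g)\<^sup>2 * exp (- a) * k)
      + 8 * (C\<^sup>2 / \<alpha>\<^sup>2 * M powr (- (2 * \<alpha>)))) / k"
    using k by (intro divide_right_mono) auto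
  also have "\<dots> = 2 * (L1norm g)\<^sup>2 * exp (- a) + 8 * C\<^sup>2 / \<alpha>\<^sup>2 * (M powr (- (2 * \<alpha>)) / k)"
    using k by (simp add: add_divide_distrib)
  finally show ?thesis by (simp add: M_def)
qed

section \<open>Integration over all frequencies\<close>

lemma L1norm_nonneg: "0 \<le> L1norm g"
  unfolding L1norm_def by (cases "(\<lambda>y. norm (g y)) integrable_on UNIV")
    (auto intro: integral_nonneg simp: not_integrable_integral)

lemma L1norm_shift:
  assumes "g absolutely_integrable_on UNIV"
  shows "L1norm (\<lambda>y. g (y - a)) = L1norm g"
proof -
  have "(\<lambda>y. norm (g y)) absolutely_integrable_on UNIV"
    using absolutely_integrable_norm[OF assms] by (simp add: o_def)
  from absolutely_integrable_real_affine(2)[OF this, of 1 "- a"]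
  show ?thesis by (simp add: L1norm_def)
qed

lemma abs_diff_squares_div_le:
  fixes x y :: real
  assumes "x\<^sup>2 / k \<le> B" "y\<^sup>2 / k \<le> B" "k > 0"
  shows "\<bar>x\<^sup>2 - y\<^sup>2\<bar> / k \<le> B"
proof -
  have "0 \<le> x\<^sup>2 / k" "0 \<le> y\<^sup>2 / k" using assms(3) by auto
  then have "\<bar>x\<^sup>2 / k - y\<^sup>2 / k\<bar> \<le> B" using assms(1,2) by linarith
  then show ?thesis using assms(3) by (simp flip: diff_divide_distrib)
qed

theorem theorem4:
  fixes f f' :: "real \<Rightarrow> complex" and C L \<alpha> y\<^sub>o :: real
  assumes f_int: "f absolutely_integrable_on UNIV"
    and f_deriv: "\<And>y. (f has_vector_derivative f' y) (at y)"
    and f'_int: "f' absolutely_integrable_on UNIV"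
    and FT_neg: "\<And>p. p < 0 \<Longrightarrow> FT f p = 0"
    and norm1: "((\<lambda>p. (cmod (FT f p))\<^sup>2 / (2 * p)) has_integral 1) {0<..}"
    and C_pos: "C > 0" and L_ge: "L \<ge> 1" and alpha_gt: "\<alpha> > 1/2"
    and decay: "\<And>y. y \<le> - L \<Longrightarrow> cmod (f y) \<le> C / \<bar>y\<bar> powr (1 + \<alpha>)"
    and yo_pos: "y\<^sub>o > 0"
  shows "\<exists>I. ((\<lambda>k. ((cmod (checkFT (\<lambda>y. f (y - y\<^sub>o)) k))\<^sup>2
                    - (cmod (checkFT_Th (\<lambda>y. f (y - y\<^sub>o)) k))\<^sup>2) / (2 * k))
               has_integral I) {0<..}
         \<and> \<bar>I\<bar> \<le> 1 / (\<alpha>\<^sup>2 * (2 * \<alpha> - 1)) * (32 * C\<^sup>2 / (y\<^sub>o / 4 + L - 1) powr (2 * \<alpha> - 1))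
                  + exp (4 * L - y\<^sub>o / 4) * (L1norm f + L1norm f')\<^sup>2"
proof -
  define g where "g = (\<lambda>y. f (y - y\<^sub>o))"
  define g' where "g' = (\<lambda>y. f' (y - y\<^sub>o))"
  define A where "A = L1norm f"
  define B where "B = L1norm f'"
  have A0: "A \<ge> 0" and B0: "B \<ge> 0" by (simp_all add: A_def B_def L1norm_nonneg)
  have g: "g absolutely_integrable_on UNIV" and g': "g' absolutely_integrable_on UNIV"
    using absolutely_integrable_real_affine(1)[OF f_int, of 1 "- y\<^sub>o"]
      absolutely_integrable_real_affine(1)[OF f'_int, of 1 "- y\<^sub>o"] by (simp_all add: g_def g'_def)
  have norms: "L1norm g = A" "L1norm g' = B"
    using L1norm_shift f_int f'_int by (simp_all add: g_def g'_def A_def B_def)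
  have mean: "integral UNIV g = 0"
    using absolutely_integrable_real_affine(2)[OF f_int, of 1 "- y\<^sub>o"]
      integral_eq_zero_if_FT_neg[OF f_int FT_neg] by (simp add: g_def)
  have der: "(g has_vector_derivative g' y) (at y)" for y
  proof -
    have "(f \<circ> (\<lambda>y. y - y\<^sub>o) has_vector_derivative 1 *\<^sub>R f' (y - y\<^sub>o)) (at y)"
      by (rule vector_diff_chain_at[OF _ f_deriv]) (auto intro!: derivative_eq_intros)
    then show ?thesis by (simp add: g_def g'_def o_def)
  qed
  define X where "X = osc g xmap"
  define Y where "Y = osc g (\<lambda>y. - exp (- y))"
  \<comment> \<open>With this choice \<open>b\<close> is \<open>exp (y\<^sub>o / 2 - 2 * L)\<close>,
    and \<open>k < b\<close> puts the cut at distance more than \<open>M \<ge> L\<close>, where the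
    decay of \<open>f\<close> applies.\<close>
  define M where "M = y\<^sub>o / 4 + L"
  define b where "b = exp (y\<^sub>o - 2 * M)"
  have M: "M > 0" "M \<ge> L" using L_ge yo_pos by (auto simp: M_def)
  have b: "b > 0" by (simp add: b_def)
  have XA: "cmod (X k) \<le> A" and YA: "cmod (Y k) \<le> A" for k
    using norm_osc_le[OF g continuous_on_xmap] norm_osc_le[OF g continuous_on_neg_exp_neg]
    by (simp_all add: X_def Y_def norms)
  have low: "\<bar>(cmod (X k))\<^sup>2 - (cmod (Y k))\<^sup>2\<bar> / k \<le> 2 * A\<^sup>2 * exp (- y\<^sub>o)
      + 8 * C\<^sup>2 / \<alpha>\<^sup>2 * (((y\<^sub>o - ln k) / 2) powr (- (2 * \<alpha>)) / k)" if k: "0 < k" "k < b" for k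
  proof (rule abs_diff_squares_div_le[OF _ _ k(1)])
    have "ln k < y\<^sub>o - 2 * M"
      using k unfolding b_def by (metis ln_less_cancel_iff ln_exp exp_gt_zero)
    then have m: "(y\<^sub>o - ln k) / 2 > M" by simp
    have tail: "integral {..y\<^sub>o - (y\<^sub>o - ln k) / 2} (\<lambda>y. cmod (g y))
        \<le> C / (\<alpha> * ((y\<^sub>o - ln k) / 2) powr \<alpha>)"
      unfolding g_def
    proof (rule tail_integral_le[OF f_int])
      show "cmod (f y) \<le> C / \<bar>y\<bar> powr (1 + \<alpha>)" if "y \<le> - ((y\<^sub>o - ln k) / 2)" for y
        by (rule decay) (use that m M in linarith)
    qed (use m M alpha_gt in linarith)+
    have "y\<^sub>o > ln k" using m M by simp
    \<comment> \<open>One estimate serves both phases, since each is bounded by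
      \<open>exp (- y)\<close>.\<close>
    note lf = norm_osc_low_frequency_decay[OF g _ mean _ k(1) tail this, unfolded norms]
    show "(cmod (X k))\<^sup>2 / k \<le> 2 * A\<^sup>2 * exp (- y\<^sub>o)
      + 8 * C\<^sup>2 / \<alpha>\<^sup>2 * (((y\<^sub>o - ln k) / 2) powr (- (2 * \<alpha>)) / k)"
      unfolding X_def by (rule lf[OF continuous_on_xmap abs_xmap_le])
    show "(cmod (Y k))\<^sup>2 / k \<le> 2 * A\<^sup>2 * exp (- y\<^sub>o)
      + 8 * C\<^sup>2 / \<alpha>\<^sup>2 * (((y\<^sub>o - ln k) / 2) powr (- (2 * \<alpha>)) / k)"
      unfolding Y_def by (rule lf[OF continuous_on_neg_exp_neg]) simp
  qed
  have high: "\<bar>(cmod (X k))\<^sup>2 - (cmod (Y k))\<^sup>2\<bar> / k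
      \<le> 2 * A * (B * k powr (- 2) + 2 * (A + B) * k powr (- 3 / 2))" if k: "0 < k" for k
  proof -
    \<comment> \<open>The first factor is small by the high-frequency bound, the second is at most
      \<open>2 * A\<close>.\<close>
    have "\<bar>(cmod (X k))\<^sup>2 - (cmod (Y k))\<^sup>2\<bar> = \<bar>cmod (X k) - cmod (Y k)\<bar> * (cmod (X k) + cmod (Y k))"
      by (simp add: power2_eq_square square_diff_square_factored abs_mult mult.commute)
    also have "\<dots> \<le> (B / k + 2 * (A + B) / sqrt k) * (2 * A)"
    proof (rule mult_mono)
      have "\<bar>cmod (X k) - cmod (Y k)\<bar> \<le> cmod (X k - Y k)" by (rule norm_triangle_ineq3)
      also have "\<dots> \<le> B / k + 2 * (A + B) / sqrt k"
        using norm_osc_diff_high_frequency[OF g g' der k] by (simp add: X_def Y_def norms)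
      finally show "\<bar>cmod (X k) - cmod (Y k)\<bar> \<le> B / k + 2 * (A + B) / sqrt k" .
    qed (use XA[of k] YA[of k] A0 B0 k in auto)
    finally have "\<bar>(cmod (X k))\<^sup>2 - (cmod (Y k))\<^sup>2\<bar> / k \<le> (B / k + 2 * (A + B) / sqrt k) * (2 * A) / k"
      using k by (intro divide_right_mono) auto
    also have "\<dots> = 2 * A * (B * (1 / (k * k)) + 2 * (A + B) * (1 / (sqrt k * k)))"
      by (simp add: algebra_simps add_divide_distrib)
    also have "1 / (k * k) = k powr (- 2)"
      using k by (simp add: powr_minus power2_eq_square divide_inverse)
    also have "1 / (sqrt k * k) = k powr (- 3 / 2)"
    proof -
      have "sqrt k * k = k powr (1 / 2) * k powr 1" using k by (simp add: powr_half_sqrt)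
      also have "\<dots> = k powr (3 / 2)" by (simp only: powr_add[symmetric]) simp
      finally show ?thesis using powr_minus_divide[of k "3 / 2"] by simp
    qed
    finally show ?thesis .
  qed
  define F where "F = (\<lambda>k. ((cmod (checkFT g k))\<^sup>2 - (cmod (checkFT_Th g k))\<^sup>2) / (2 * k))"
  have F: "F k = 1 / (4 * pi) * (((cmod (X k))\<^sup>2 - (cmod (Y k))\<^sup>2) / k)" for k
    unfolding F_def checkFT_eq_osc checkFT_Th_eq_osc X_def Y_def
    by (simp add: norm_mult norm_divide power_mult_distrib power_divide diff_divide_distrib mult_ac)
  \<comment> \<open>\<open>W1\<close> and \<open>W2\<close> majorise \<open>norm (F k)\<close> below
    and above \<open>b\<close>; \<open>J1\<close> and \<open>J2\<close> are their integrals over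
    these ranges.\<close>
  define W1 where "W1 = (\<lambda>k. 1 / (4 * pi) * (2 * A\<^sup>2 * exp (- y\<^sub>o)
      + 8 * C\<^sup>2 / \<alpha>\<^sup>2 * (((y\<^sub>o - ln k) / 2) powr (- (2 * \<alpha>)) / k)))"
  define W2 where "W2 = (\<lambda>k. 1 / (4 * pi) * (2 * A * (B * k powr (- 2) + 2 * (A + B) * k powr (- 3 / 2))))"
  define J1 where "J1 = 1 / (4 * pi) * (2 * A\<^sup>2 * exp (- y\<^sub>o) * b
      + 8 * C\<^sup>2 / \<alpha>\<^sup>2 * (2 / (2 * \<alpha> - 1) * M powr (1 - 2 * \<alpha>)))"
  define J2 where "J2 = 1 / (4 * pi) * (2 * A * (B * b powr (- 1) + 2 * (A + B) * (2 * b powr (- 1 / 2))))"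
  have W1: "(W1 has_integral J1) {0<..<b}"
  proof -
    have "((\<lambda>k. 2 * A\<^sup>2 * exp (- y\<^sub>o)) has_integral 2 * A\<^sup>2 * exp (- y\<^sub>o) * b) {0..b}"
      using has_integral_const_real[of "2 * A\<^sup>2 * exp (- y\<^sub>o)" 0 b] b by (simp add: mult.commute)
    then have "((\<lambda>k. 2 * A\<^sup>2 * exp (- y\<^sub>o)) has_integral 2 * A\<^sup>2 * exp (- y\<^sub>o) * b) {0<..<b}"
      by (simp only: has_integral_Icc_iff_Ioo)
    moreover have "((\<lambda>k. ((y\<^sub>o - ln k) / 2) powr (- (2 * \<alpha>)) / k) has_integral
        2 / (2 * \<alpha> - 1) * M powr (1 - 2 * \<alpha>)) {0<..<b}"
      unfolding b_def using alpha_gt by (intro has_integral_log_powr M) simp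
    ultimately show ?thesis
      unfolding W1_def J1_def by (intro has_integral_mult_right has_integral_add)
  qed
  have W2: "(W2 has_integral J2) {b..}"
  proof -
    have "((\<lambda>k. k powr (- 2)) has_integral b powr (- 1)) {b..}"
      using has_integral_powr_to_inf[of "- 2" b] b by simp
    moreover have "((\<lambda>k. k powr (- 3 / 2)) has_integral 2 * b powr (- 1 / 2)) {b..}"
      using has_integral_powr_to_inf[of "- 3 / 2" b] b by (simp add: mult.commute)
    ultimately show ?thesis
      unfolding W2_def J2_def by (intro has_integral_mult_right has_integral_add)
  qed
  define W where "W = (\<lambda>k. if k < b then W1 k else W2 k)"
  have W: "(W has_integral J1 + J2) {0<..}"
  proof -
    have "(W has_integral J1) {0<..<b}" "(W has_integral J2) {b..}"
      using has_integral_eq[OF _ W1, of W] has_integral_eq[OF _ W2, of W] by (auto simp: W_def)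
    then have "(W has_integral J1 + J2) ({0<..<b} \<union> {b..})"
      by (rule has_integral_Un) (simp add: ivl_disj_int)
    moreover have "{0<..<b} \<union> {b..} = {0<..}" using b by auto
    ultimately show ?thesis by simp
  qed
  have FW: "norm (F k) \<le> W k" if "k \<in> {0<..}" for k
  proof -
    have "norm (F k) = 1 / (4 * pi) * (\<bar>(cmod (X k))\<^sup>2 - (cmod (Y k))\<^sup>2\<bar> / k)"
      using that by (simp add: F abs_mult)
    also have "\<dots> \<le> W k"
    proof (cases "k < b")
      case True
      then show ?thesis unfolding W_def W1_def if_P[OF True]
        using that by (intro mult_left_mono low) auto
    next
      case False
      then show ?thesis unfolding W_def W2_def if_not_P[OF False]
        using that by (intro mult_left_mono high) auto
    qed
    finally show ?thesis .
  qed
  have "continuous_on {0<..} F"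
    unfolding F[abs_def] X_def Y_def
    by (intro continuous_intros continuous_on_osc g continuous_on_xmap continuous_on_neg_exp_neg) auto
  then have Fm: "F \<in> borel_measurable (lebesgue_on {0<..})"
    by (intro continuous_imp_measurable_on_sets_lebesgue) auto
  have Fi: "F integrable_on {0<..}"
    by (rule measurable_bounded_by_integrable_imp_integrable[OF Fm _ FW])
      (use W in auto)
  have "norm (integral {0<..} F) \<le> J1 + J2"
    by (rule integral_norm_bound_integral'[OF FW Fm _ W]) auto
  also have "J1 + J2 \<le> 1 / (\<alpha>\<^sup>2 * (2 * \<alpha> - 1)) * (32 * C\<^sup>2 / (y\<^sub>o / 4 + L - 1) powr (2 * \<alpha> - 1))
                  + exp (4 * L - y\<^sub>o / 4) * (A + B)\<^sup>2"
  proof -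
    define D where "D = 1 / (\<alpha>\<^sup>2 * (2 * \<alpha> - 1))"
    define P where "P = 1 / (y\<^sub>o / 4 + L - 1) powr (2 * \<alpha> - 1)"
    define Q where "Q = exp (4 * L - y\<^sub>o / 4)"
    have D0: "D \<ge> 0" using alpha_gt by (simp add: D_def)
    have P0: "P \<ge> 0" by (simp add: P_def)
    have "M powr (1 - 2 * \<alpha>) = 1 / M powr (2 * \<alpha> - 1)"
      using powr_minus_divide[of M "2 * \<alpha> - 1"] by simp
    \<comment> \<open>Replacing \<open>M\<close> by the smaller \<open>M - 1\<close>, positive
      because \<open>L \<ge> 1\<close> and \<open>y\<^sub>o > 0\<close>, only enlarges the
      reciprocal power.\<close>
    also have "\<dots> \<le> P"
      unfolding P_def using M yo_pos L_ge alpha_gt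
      by (intro divide_left_mono powr_mono2 mult_pos_pos) (auto simp: M_def)
    finally have MP: "M powr (1 - 2 * \<alpha>) \<le> P" .
    \<comment> \<open>The exponents in \<open>Q1\<close>, \<open>Q2\<close>, \<open>Q3\<close> are
      \<open>- y\<^sub>o / 2 - 2 * L\<close>, \<open>2 * L - y\<^sub>o / 2\<close> and
      \<open>L - y\<^sub>o / 4\<close>; the last one dictates the rate
      \<open>y\<^sub>o / 4\<close>.\<close>
    have Q1: "exp (- y\<^sub>o) * b \<le> Q"
      using L_ge yo_pos by (simp add: b_def Q_def M_def flip: exp_add)
    have Q2: "b powr (- 1) \<le> Q"
      using L_ge yo_pos by (simp add: b_def Q_def M_def powr_def)
    have Q3: "b powr (- 1 / 2) \<le> Q"
      using L_ge yo_pos by (simp add: b_def Q_def M_def powr_def) (simp add: field_simps)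
    have "8 * C\<^sup>2 / \<alpha>\<^sup>2 * (2 / (2 * \<alpha> - 1) * M powr (1 - 2 * \<alpha>)) = 16 * C\<^sup>2 * D * M powr (1 - 2 * \<alpha>)"
      by (simp add: D_def)
    also have "\<dots> \<le> 16 * C\<^sup>2 * D * P"
      using D0 by (intro mult_left_mono MP) auto
    finally have "J1 \<le> 1 / (4 * pi) * (2 * A\<^sup>2 * Q + 16 * C\<^sup>2 * D * P)"
      unfolding J1_def using mult_left_mono[OF Q1, of "2 * A\<^sup>2"]
      by (intro mult_left_mono add_mono) (auto simp: mult.assoc)
    moreover have "J2 \<le> 1 / (4 * pi) * (2 * A * (B * Q + 2 * (A + B) * (2 * Q)))"
      unfolding J2_def using A0 B0 Q2 Q3 by (intro mult_left_mono add_mono) auto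
    ultimately have "J1 + J2 \<le> 1 / (4 * pi) * (10 * A * (A + B) * Q + 16 * C\<^sup>2 * D * P)"
      by (simp add: algebra_simps power2_eq_square)
    \<comment> \<open>Since \<open>pi > 3\<close>, the prefactor is at most \<open>1 / 12\<close>,
      which brings the constants 10 and 16 below 1 and 32.\<close>
    also have "\<dots> \<le> 1 / 12 * (10 * A * (A + B) * Q + 16 * C\<^sup>2 * D * P)"
      using pi_gt3 A0 B0 D0 P0 by (intro mult_right_mono) (auto simp: Q_def divide_simps)
    also have "\<dots> = 10 / 12 * (A * (A + B) * Q) + 16 / 12 * (C\<^sup>2 * D * P)"
      by (simp add: algebra_simps)
    also have "\<dots> \<le> (A + B) * (A + B) * Q + 32 * (C\<^sup>2 * D * P)"
    proof (rule add_mono)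
      have "10 / 12 * (A * (A + B) * Q) \<le> 1 * (A * (A + B) * Q)"
        using A0 B0 by (intro mult_right_mono) (auto simp: Q_def)
      also have "\<dots> \<le> (A + B) * (A + B) * Q"
        unfolding mult_1 using A0 B0 by (intro mult_right_mono) (auto simp: Q_def)
      finally show "10 / 12 * (A * (A + B) * Q) \<le> (A + B) * (A + B) * Q" .
      show "16 / 12 * (C\<^sup>2 * D * P) \<le> 32 * (C\<^sup>2 * D * P)"
        using D0 P0 by (intro mult_right_mono) auto
    qed
    finally show ?thesis by (simp add: D_def P_def Q_def power2_eq_square mult_ac)
  qed
  finally have "\<bar>integral {0<..} F\<bar> \<le> 1 / (\<alpha>\<^sup>2 * (2 * \<alpha> - 1)) * (32 * C\<^sup>2 / (y\<^sub>o / 4 + L - 1) powr (2 * \<alpha> - 1))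
                  + exp (4 * L - y\<^sub>o / 4) * (L1norm f + L1norm f')\<^sup>2"
    by (simp add: A_def B_def)
  moreover have "(F has_integral integral {0<..} F) {0<..}"
    using Fi by (rule integrable_integral)
  ultimately show ?thesis
    unfolding F_def g_def by blast
qed

end
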